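(* Let $n,\ell,r,m$ be positive integers, let $\boldsymbol{y}\in\mathbb{R}^n$, and let $\boldsymbol{Z}\in\mathbb{R}^{n\times \ell}$, $\boldsymbol{U}\in\mathbb{R}^{n\times r}$, $\boldsymbol{T}\in\mathbb{R}^{n\times m}$ be real matrices such that $\mathrm{rank}(\boldsymbol{Z})=n<\ell$, $\mathrm{rank}(\boldsymbol{U})=r<n$ and $\mathrm{rank}(\boldsymbol{T})=m<n$. Let $\mathcal{S}_1,\mathcal{S}_2,\mathcal{S}_3$ be the least squares solution sets defined in the context. (i) For any $(\widehat{\boldsymbol{\alpha}},\widehat{\boldsymbol{\gamma}},\widehat{\boldsymbol{\tau}})\in\mathcal{S}_1$, $(\widetilde{\boldsymbol{\alpha}},\widetilde{\boldsymbol{\tau}})\in\mathcal{S}_2$ and $(\widehat{\boldsymbol{\Delta}},\widehat{\boldsymbol{\delta}})\in\mathcal{S}_3$, $$\boldsymbol{Z}\widetilde{\boldsymbol{\alpha}}+\boldsymbol{T}\widetilde{\boldsymbol{\tau}}=\boldsymbol{Z}(\widehat{\boldsymbol{\alpha}}+\widehat{\boldsymbol{\Delta}}\widehat{\boldsymbol{\gamma}})+\boldsymbol{T}(\widehat{\boldsymbol{\tau}}+\widehat{\boldsymbol{\delta}}\widehat{\boldsymbol{\gamma}}).$$ (ii) If moreover $(\widehat{\boldsymbol{\alpha}},\widehat{\boldsymbol{\gamma}},\widehat{\boldsymbol{\tau}})$, $(\widetilde{\boldsymbol{\alpha}},\widetilde{\boldsymbol{\tau}})$ and $(\widehat{\boldsymbol{\Delta}},\widehat{\boldsymbol{\delta}})$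 are the partially regularized least squares solutions defined in the context, then $$\begin{pmatrix}\widetilde{\boldsymbol{\alpha}}\\ \widetilde{\boldsymbol{\tau}}\end{pmatrix}=\begin{pmatrix}\widehat{\boldsymbol{\alpha}}\\ \widehat{\boldsymbol{\tau}}\end{pmatrix}+\begin{pmatrix}\widehat{\boldsymbol{\Delta}}\\ \widehat{\boldsymbol{\delta}}\end{pmatrix}\widehat{\boldsymbol{\gamma}}.$$
   Context: The least squares solution sets are $$\mathcal{S}_1=\arg\min_{\boldsymbol{\alpha}\in\mathbb{R}^\ell,\,\boldsymbol{\gamma}\in\mathbb{R}^r,\,\boldsymbol{\tau}\in\mathbb{R}^m}\|\boldsymbol{y}-(\boldsymbol{Z}\boldsymbol{\alpha}+\boldsymbol{U}\boldsymbol{\gamma}+\boldsymbol{T}\boldsymbol{\tau})\|_2^2,$$ $$\mathcal{S}_2=\arg\min_{\boldsymbol{\alpha}\in\mathbb{R}^\ell,\,\boldsymbol{\tau}\in\mathbb{R}^m}\|\boldsymbol{y}-(\boldsymbol{Z}\boldsymbol{\alpha}+\boldsymbol{T}\boldsymbol{\tau})\|_2^2,$$ $$\mathcal{S}_3=\arg\min_{\boldsymbol{\Delta}\in\mathbb{R}^{\ell\times r},\,\boldsymbol{\delta}\in\mathbb{R}^{m\times r}}\|\boldsymbol{U}-(\boldsymbol{Z}\boldsymbol{\Delta}+\boldsymbol{T}\boldsymbol{\delta})\|_F^2,$$ where $\|\cdot\|_F$ is the Frobenius norm and $\arg\min$ denotes the set of all minimizers. The partially regularized solutions (in which the coefficients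 of $\boldsymbol{T}$ are not penalized) are $$(\widehat{\boldsymbol{\alpha}},\widehat{\boldsymbol{\gamma}},\widehat{\boldsymbol{\tau}})=\arg\min_{(\boldsymbol{\alpha},\boldsymbol{\gamma},\boldsymbol{\tau})\in\mathcal{S}_1}\left(\|\boldsymbol{\alpha}\|_2^2+\|\boldsymbol{\gamma}\|_2^2\right),\quad (\widetilde{\boldsymbol{\alpha}},\widetilde{\boldsymbol{\tau}})=\arg\min_{(\boldsymbol{\alpha},\boldsymbol{\tau})\in\mathcal{S}_2}\|\boldsymbol{\alpha}\|_2^2,\quad (\widehat{\boldsymbol{\Delta}},\widehat{\boldsymbol{\delta}})=\arg\min_{(\boldsymbol{\Delta},\boldsymbol{\delta})\in\mathcal{S}_3}\|\boldsymbol{\Delta}\|_F^2.$$ *)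

theory Defs
  imports "HOL-Analysis.Analysis"
begin

definition arg_min_set :: "('a \<Rightarrow> real) \<Rightarrow> 'a set \<Rightarrow> 'a set" where
  "arg_min_set f S = {x. is_arg_min f (\<lambda>x. x \<in> S) x}"

lemma mem_arg_min_set_iff:
  "x \<in> arg_min_set f S \<longleftrightarrow> x \<in> S \<and> (\<forall>y\<in>S. f x \<le> f y)"
  by (auto simp: arg_min_set_def is_arg_min_linorder)

definition frobenius_norm :: "real^'c^'r \<Rightarrow> real" where
  "frobenius_norm A = sqrt (\<Sum>i\<in>UNIV. \<Sum>j\<in>UNIV. (A $ i $ j)\<^sup>2)"

lemma frobenius_norm_eq_norm: "frobenius_norm A = norm A"
  by (simp add: frobenius_norm_def norm_vec_def L2_set_def sum_nonneg)

definition vec_stack :: "'a^'p \<Rightarrow> 'a^'q \<Rightarrow> 'a^('p + 'q)" where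
  "vec_stack u v = (\<chi> k. case k of Inl i \<Rightarrow> u $ i | Inr j \<Rightarrow> v $ j)"

text \<open>A matrix is a vector of its rows, so \<open>vec_stack A B\<close> for
  \<open>A :: real^'c^'p\<close> and \<open>B :: real^'c^'q\<close> is the block matrix with
  \<open>A\<close> on top of \<open>B\<close>.\<close>

lemma vec_stack_matrix_vector_mult:
  fixes A :: "real^'c^'p" and B :: "real^'c^'q"
  shows "vec_stack A B *v x = vec_stack (A *v x) (B *v x)"
  by (simp add: vec_eq_iff vec_stack_def matrix_vector_mult_def split: sum.split)

definition ls_full ::
  "real^'n \<Rightarrow> real^'l^'n \<Rightarrow> real^'r^'n \<Rightarrow> real^'m^'n \<Rightarrow> ((real^'l) \<times> (real^'r) \<times> (real^'m)) set" where
  "ls_full y Z U T =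
     arg_min_set (\<lambda>(\<alpha>, \<gamma>, \<tau>). (norm (y - (Z *v \<alpha> + U *v \<gamma> + T *v \<tau>)))\<^sup>2) UNIV"

definition ls_reduced ::
  "real^'n \<Rightarrow> real^'l^'n \<Rightarrow> real^'m^'n \<Rightarrow> ((real^'l) \<times> (real^'m)) set" where
  "ls_reduced y Z T =
     arg_min_set (\<lambda>(\<alpha>, \<tau>). (norm (y - (Z *v \<alpha> + T *v \<tau>)))\<^sup>2) UNIV"

definition ls_matrix ::
  "real^'r^'n \<Rightarrow> real^'l^'n \<Rightarrow> real^'m^'n \<Rightarrow> ((real^'r^'l) \<times> (real^'r^'m)) set" where
  "ls_matrix U Z T =
     arg_min_set (\<lambda>(\<Delta>, \<delta>). (frobenius_norm (U - (Z ** \<Delta> + T ** \<delta>)))\<^sup>2) UNIV"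

text \<open>\<open>pr\<close> stands for partially regularized: among the least squares solutions (\<open>ls\<close>),
  minimize the norm of all coefficients except those of \<open>T\<close>.\<close>

definition pr_full ::
  "real^'n \<Rightarrow> real^'l^'n \<Rightarrow> real^'r^'n \<Rightarrow> real^'m^'n \<Rightarrow> ((real^'l) \<times> (real^'r) \<times> (real^'m)) set" where
  "pr_full y Z U T =
     arg_min_set (\<lambda>(\<alpha>, \<gamma>, \<tau>). (norm \<alpha>)\<^sup>2 + (norm \<gamma>)\<^sup>2) (ls_full y Z U T)"

definition pr_reduced ::
  "real^'n \<Rightarrow> real^'l^'n \<Rightarrow> real^'m^'n \<Rightarrow> ((real^'l) \<times> (real^'m)) set" where
  "pr_reduced y Z T = arg_min_set (\<lambda>(\<alpha>, \<tau>). (norm \<alpha>)\<^sup>2) (ls_reduced y Z T)"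

definition pr_matrix ::
  "real^'r^'n \<Rightarrow> real^'l^'n \<Rightarrow> real^'m^'n \<Rightarrow> ((real^'r^'l) \<times> (real^'r^'m)) set" where
  "pr_matrix U Z T = arg_min_set (\<lambda>(\<Delta>, \<delta>). (frobenius_norm \<Delta>)\<^sup>2) (ls_matrix U Z T)"

end

(* Since Z has full row rank, every least squares problem here is solved exactly, so part (i) amounts to
   substituting U = Z \<Delta> + T \<delta> into y = Z \<alpha> + U \<gamma> + T \<tau>. For part (ii), let K be the subspace of all a with
   Z a in the range of T. Minimality of the penalized norms makes both sides of the claimed identity
   for \<alpha> orthogonal to K, while their difference lies in K. The identity for \<tau> follows as T is
   injective. *)
theory Submission
  imports Defs
begin

text \<open>First-order condition at a minimum along a line: the squared norm is a quadratic in
  \<open>t\<close> that is least at \<open>t = 0\<close>, so its linear coefficient vanishes. All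
  orthogonality facts below come from this.\<close>

lemma inner_eq_0_if_norm_minimal:
  fixes x d :: "'a::real_inner"
  assumes min: "\<And>t. (norm x)\<^sup>2 \<le> (norm (x + t *\<^sub>R d))\<^sup>2"
  shows "x \<bullet> d = 0"
proof (cases "d = 0")
  case False
  \<comment> \<open>The vertex of the quadratic, where the squared norm drops by
    \<open>(x \<bullet> d)\<^sup>2 / (d \<bullet> d)\<close>; minimality forces this drop to be
    zero.\<close>
  define t where "t = - (x \<bullet> d) / (d \<bullet> d)"
  have "d \<bullet> d > 0"
    using False by simp
  have "(norm (x + t *\<^sub>R d))\<^sup>2 = (norm x)\<^sup>2 + (2 * t * (x \<bullet> d) + t\<^sup>2 * (d \<bullet> d))"
    unfolding power2_norm_eq_inner
    by (simp add: inner_add_left inner_add_right inner_commute power2_eq_square)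
  also have "2 * t * (x \<bullet> d) + t\<^sup>2 * (d \<bullet> d) = - ((x \<bullet> d)\<^sup>2 / (d \<bullet> d))"
    using \<open>d \<bullet> d > 0\<close> by (simp add: t_def power2_eq_square field_simps)
  finally have "(x \<bullet> d)\<^sup>2 / (d \<bullet> d) \<le> 0"
    using min[of t] by simp
  then show ?thesis
    using \<open>d \<bullet> d > 0\<close> by (simp add: divide_le_0_iff)
qed simp

text \<open>A zero of \<open>f\<close> brings the minimum down to 0, so least squares minimization
  turns into solving an equation.\<close>

lemma arg_min_set_norm_eq_0:
  assumes "f x0 = 0"
  shows "arg_min_set (\<lambda>x. (norm (f x))\<^sup>2) UNIV = {x. f x = 0}"
proof -
  have "x \<in> arg_min_set (\<lambda>x. (norm (f x))\<^sup>2) UNIV \<longleftrightarrow> f x = 0" for x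
  proof
    assume "x \<in> arg_min_set (\<lambda>x. (norm (f x))\<^sup>2) UNIV"
    then have "(norm (f x))\<^sup>2 \<le> (norm (f x0))\<^sup>2"
      by (simp add: mem_arg_min_set_iff)
    then show "f x = 0"
      using assms by simp
  qed (simp add: mem_arg_min_set_iff)
  then show ?thesis
    by blast
qed

text \<open>The rank-one matrix with entries \<open>a $ i * c $ j\<close>. Such matrices serve as
  perturbation directions for the matrix problem.\<close>

definition outer_prod :: "real^'m \<Rightarrow> real^'n \<Rightarrow> real^'n^'m" where
  "outer_prod a c = (\<chi> i. a $ i *\<^sub>R c)"

lemma matrix_mult_outer_prod: "A ** outer_prod a c = outer_prod (A *v a) c"
  by (simp add: vec_eq_iff outer_prod_def matrix_matrix_mult_def matrix_vector_mult_def
      sum_distrib_right mult.assoc)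

text \<open>Turns orthogonality in the Frobenius inner product into orthogonality of the vectors
  \<open>A *v c\<close> and \<open>a\<close>.\<close>

lemma inner_outer_prod: "A \<bullet> outer_prod a c = (A *v c) \<bullet> a"
  by (simp add: outer_prod_def inner_vec_def matrix_vector_mult_def sum_distrib_left
      sum_distrib_right mult_ac)

lemma outer_prod_minus_left: "outer_prod (- a) c = - outer_prod a c"
  by (simp add: vec_eq_iff outer_prod_def)

lemma matrix_mult_scaleR_right:
  fixes A :: "real^'n^'m" and B :: "real^'k^'n"
  shows "A ** (t *\<^sub>R B) = t *\<^sub>R (A ** B)"
  by (simp add: vec_eq_iff matrix_matrix_mult_def sum_distrib_left mult_ac)

context
  fixes Z :: "real^'l^'n"
  assumes rank_Z: "rank Z = CARD('n)"
begin

lemma right_inverse_exists: "\<exists>B. Z ** B = mat 1"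
  using rank_Z full_rank_surjective matrix_right_invertible_surjective by blast

lemma ls_full_iff:
  "(\<alpha>, \<gamma>, \<tau>) \<in> ls_full y Z U T \<longleftrightarrow> Z *v \<alpha> + U *v \<gamma> + T *v \<tau> = y"
proof -
  obtain B where "Z ** B = mat 1"
    using right_inverse_exists by blast
  \<comment> \<open>An exact fit using \<open>Z\<close> alone: the right inverse \<open>B\<close>
    gives \<open>Z *v (B *v y) = y\<close>, and the other coefficients are set to zero.\<close>
  then have *: "(\<lambda>(\<alpha>, \<gamma>, \<tau>). y - (Z *v \<alpha> + U *v \<gamma> + T *v \<tau>)) (B *v y, 0, 0) = 0"
    by (simp add: matrix_vector_mul_assoc)
  show ?thesis
    using arg_min_set_norm_eq_0[of "\<lambda>(\<alpha>, \<gamma>, \<tau>). y - (Z *v \<alpha> + U *v \<gamma> + T *v \<tau>)", OF *]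
    by (auto simp: ls_full_def case_prod_unfold)
qed

lemma ls_reduced_iff:
  "(\<alpha>, \<tau>) \<in> ls_reduced y Z T \<longleftrightarrow> Z *v \<alpha> + T *v \<tau> = y"
proof -
  obtain B where "Z ** B = mat 1"
    using right_inverse_exists by blast
  then have *: "(\<lambda>(\<alpha>, \<tau>). y - (Z *v \<alpha> + T *v \<tau>)) (B *v y, 0) = 0"
    by (simp add: matrix_vector_mul_assoc)
  show ?thesis
    using arg_min_set_norm_eq_0[of "\<lambda>(\<alpha>, \<tau>). y - (Z *v \<alpha> + T *v \<tau>)", OF *]
    by (auto simp: ls_reduced_def case_prod_unfold)
qed

lemma ls_matrix_iff:
  "(\<Delta>, \<delta>) \<in> ls_matrix U Z T \<longleftrightarrow> Z ** \<Delta> + T ** \<delta> = U"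
proof -
  obtain B where "Z ** B = mat 1"
    using right_inverse_exists by blast
  then have *: "(\<lambda>(\<Delta>, \<delta>). U - (Z ** \<Delta> + T ** \<delta>)) (B ** U, 0) = 0"
    by (simp add: matrix_mul_assoc)
  show ?thesis
    using arg_min_set_norm_eq_0[of "\<lambda>(\<Delta>, \<delta>). U - (Z ** \<Delta> + T ** \<delta>)", OF *]
    by (auto simp: ls_matrix_def case_prod_unfold frobenius_norm_eq_norm)
qed

text \<open>Moving along \<open>(a, 0, b)\<close> leaves the fit unchanged. The change in \<tau>
  costs nothing and the \<gamma> term of the penalty stays constant, so \<alpha> alone has minimal
  norm along the line.\<close>

lemma pr_full_inner_eq_0:
  assumes "(\<alpha>, \<gamma>, \<tau>) \<in> pr_full y Z U T" and "Z *v a + T *v b = 0"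
  shows "\<alpha> \<bullet> a = 0"
proof (rule inner_eq_0_if_norm_minimal)
  fix t :: real
  have "Z *v (\<alpha> + t *\<^sub>R a) + U *v \<gamma> + T *v (\<tau> + t *\<^sub>R b)
      = Z *v \<alpha> + U *v \<gamma> + T *v \<tau> + t *\<^sub>R (Z *v a + T *v b)"
    by (simp add: matrix_vector_right_distrib matrix_vector_mult_scaleR scaleR_add_right)
  then have "(\<alpha> + t *\<^sub>R a, \<gamma>, \<tau> + t *\<^sub>R b) \<in> ls_full y Z U T"
    unfolding ls_full_iff
    using assms by (auto simp only: pr_full_def mem_arg_min_set_iff ls_full_iff scaleR_zero_right add_0_right)
  then show "(norm \<alpha>)\<^sup>2 \<le> (norm (\<alpha> + t *\<^sub>R a))\<^sup>2"
    using assms(1) by (fastforce simp: pr_full_def mem_arg_min_set_iff)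
qed

lemma pr_reduced_inner_eq_0:
  assumes "(\<alpha>, \<tau>) \<in> pr_reduced y Z T" and "Z *v a + T *v b = 0"
  shows "\<alpha> \<bullet> a = 0"
proof (rule inner_eq_0_if_norm_minimal)
  fix t :: real
  have "Z *v (\<alpha> + t *\<^sub>R a) + T *v (\<tau> + t *\<^sub>R b)
      = Z *v \<alpha> + T *v \<tau> + t *\<^sub>R (Z *v a + T *v b)"
    by (simp add: matrix_vector_right_distrib matrix_vector_mult_scaleR scaleR_add_right)
  then have "(\<alpha> + t *\<^sub>R a, \<tau> + t *\<^sub>R b) \<in> ls_reduced y Z T"
    using assms by (simp add: pr_reduced_def mem_arg_min_set_iff ls_reduced_iff)
  then show "(norm \<alpha>)\<^sup>2 \<le> (norm (\<alpha> + t *\<^sub>R a))\<^sup>2"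
    using assms(1) by (fastforce simp: pr_reduced_def mem_arg_min_set_iff)
qed

text \<open>The vector argument is lifted to matrices by the direction
  \<open>(outer_prod a c, outer_prod b c)\<close>, which for arbitrary \<open>c\<close> again
  preserves the fit.\<close>

lemma pr_matrix_inner_eq_0:
  assumes "(\<Delta>, \<delta>) \<in> pr_matrix U Z T" and "Z *v a + T *v b = 0"
  shows "(\<Delta> *v c) \<bullet> a = 0"
proof -
  have "\<Delta> \<bullet> outer_prod a c = 0"
  proof (rule inner_eq_0_if_norm_minimal)
    fix t :: real
    have "T *v b = - (Z *v a)"
      using assms(2) by (simp add: eq_neg_iff_add_eq_0 add.commute)
    then have "T ** outer_prod b c = - (Z ** outer_prod a c)"
      by (simp add: matrix_mult_outer_prod outer_prod_minus_left)
    then have "Z ** (\<Delta> + t *\<^sub>R outer_prod a c) + T ** (\<delta> + t *\<^sub>R outer_prod b c)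
        = Z ** \<Delta> + T ** \<delta>"
      by (simp add: matrix_add_ldistrib matrix_mult_scaleR_right)
    then have "(\<Delta> + t *\<^sub>R outer_prod a c, \<delta> + t *\<^sub>R outer_prod b c) \<in> ls_matrix U Z T"
      using assms(1) by (simp add: pr_matrix_def mem_arg_min_set_iff ls_matrix_iff)
    then show "(norm \<Delta>)\<^sup>2 \<le> (norm (\<Delta> + t *\<^sub>R outer_prod a c))\<^sup>2"
      using assms(1)
      by (fastforce simp: pr_matrix_def mem_arg_min_set_iff frobenius_norm_eq_norm)
  qed
  then show ?thesis
    by (simp add: inner_outer_prod)
qed

text \<open>Both sides equal \<open>y\<close>: the exact decomposition of \<open>U\<close>, applied
  to \<open>\<gamma>h\<close>, splits \<open>U *v \<gamma>h\<close> into a \<open>Z\<close> part and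
  a \<open>T\<close> part.\<close>

lemma ls_reduced_fit:
  assumes "(\<alpha>h, \<gamma>h, \<tau>h) \<in> ls_full y Z U T"
    and "(\<alpha>t, \<tau>t) \<in> ls_reduced y Z T"
    and "(\<Delta>h, \<delta>h) \<in> ls_matrix U Z T"
  shows "Z *v \<alpha>t + T *v \<tau>t = Z *v (\<alpha>h + \<Delta>h *v \<gamma>h) + T *v (\<tau>h + \<delta>h *v \<gamma>h)"
proof -
  have "U *v \<gamma>h = Z *v (\<Delta>h *v \<gamma>h) + T *v (\<delta>h *v \<gamma>h)"
    using assms(3) by (auto simp: ls_matrix_iff matrix_vector_mult_add_rdistrib matrix_vector_mul_assoc)
  then show ?thesis
    using assms(1,2) by (auto simp: ls_full_iff ls_reduced_iff matrix_vector_right_distrib)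
qed

lemma pr_reduced_eq:
  assumes rank_T: "rank T = CARD('m)"
    and full: "(\<alpha>h, \<gamma>h, \<tau>h) \<in> pr_full y Z U T"
    and reduced: "(\<alpha>t, \<tau>t) \<in> pr_reduced y Z (T :: real^'m^'n)"
    and mat: "(\<Delta>h, \<delta>h) \<in> pr_matrix U Z T"
  shows "\<alpha>t = \<alpha>h + \<Delta>h *v \<gamma>h" and "\<tau>t = \<tau>h + \<delta>h *v \<gamma>h"
proof -
  define a b where "a = \<alpha>t - (\<alpha>h + \<Delta>h *v \<gamma>h)" and "b = \<tau>t - (\<tau>h + \<delta>h *v \<gamma>h)"
  have "Z *v \<alpha>t + T *v \<tau>t = Z *v (\<alpha>h + \<Delta>h *v \<gamma>h) + T *v (\<tau>h + \<delta>h *v \<gamma>h)"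
    using full reduced mat
    by (intro ls_reduced_fit) (auto simp: pr_full_def pr_reduced_def pr_matrix_def mem_arg_min_set_iff)
  then have ker: "Z *v a + T *v b = 0"
    unfolding a_def b_def by (simp add: matrix_vector_mult_diff_distrib algebra_simps)
  \<comment> \<open>Expanding only the left factor leaves three inner products with
    \<open>a\<close>, each killed by one of the orthogonality lemmas because \<open>(a, b)\<close>
    solves \<open>ker\<close>.\<close>
  have "a \<bullet> a = \<alpha>t \<bullet> a - (\<alpha>h \<bullet> a + (\<Delta>h *v \<gamma>h) \<bullet> a)"
    by (subst (1) a_def) (simp add: inner_diff_left inner_add_left)
  also have "\<dots> = 0"
    using pr_full_inner_eq_0[OF full ker] pr_reduced_inner_eq_0[OF reduced ker]
      pr_matrix_inner_eq_0[OF mat ker] by simp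
  finally have "a = 0"
    by simp
  \<comment> \<open>With \<open>a = 0\<close> the kernel equation involves only \<open>T\<close>,
    which is injective by full column rank.\<close>
  with ker have "T *v b = T *v 0"
    by simp
  then have "b = 0"
    using rank_T full_rank_injective[of T] by (metis injD)
  show "\<alpha>t = \<alpha>h + \<Delta>h *v \<gamma>h" "\<tau>t = \<tau>h + \<delta>h *v \<gamma>h"
    using \<open>a = 0\<close> \<open>b = 0\<close> by (simp_all add: a_def b_def)
qed

end

theorem theorem1:
  fixes y :: "real^'n"
    and Z :: "real^'l^'n"
    and U :: "real^'r^'n"
    and T :: "real^'m^'n"
  assumes "rank Z = CARD('n)" and "CARD('n) < CARD('l)"
    and "rank U = CARD('r)" and "CARD('r) < CARD('n)"
    and "rank T = CARD('m)" and "CARD('m) < CARD('n)"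
  shows
    "(\<forall>\<alpha>h \<gamma>h \<tau>h \<alpha>t \<tau>t \<Delta>h \<delta>h.
        (\<alpha>h, \<gamma>h, \<tau>h) \<in> ls_full y Z U T \<longrightarrow>
        (\<alpha>t, \<tau>t) \<in> ls_reduced y Z T \<longrightarrow>
        (\<Delta>h, \<delta>h) \<in> ls_matrix U Z T \<longrightarrow>
        Z *v \<alpha>t + T *v \<tau>t = Z *v (\<alpha>h + \<Delta>h *v \<gamma>h) + T *v (\<tau>h + \<delta>h *v \<gamma>h)) \<and>
     (\<forall>\<alpha>h \<gamma>h \<tau>h \<alpha>t \<tau>t \<Delta>h \<delta>h.
        (\<alpha>h, \<gamma>h, \<tau>h) \<in> pr_full y Z U T \<longrightarrow>
        (\<alpha>t, \<tau>t) \<in> pr_reduced y Z T \<longrightarrow>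
        (\<Delta>h, \<delta>h) \<in> pr_matrix U Z T \<longrightarrow>
        vec_stack \<alpha>t \<tau>t = vec_stack \<alpha>h \<tau>h + vec_stack \<Delta>h \<delta>h *v \<gamma>h)"
proof (intro conjI allI impI)
  fix \<alpha>h \<gamma>h \<tau>h \<alpha>t \<tau>t \<Delta>h \<delta>h
  assume "(\<alpha>h, \<gamma>h, \<tau>h) \<in> ls_full y Z U T" "(\<alpha>t, \<tau>t) \<in> ls_reduced y Z T"
    "(\<Delta>h, \<delta>h) \<in> ls_matrix U Z T"
  then show "Z *v \<alpha>t + T *v \<tau>t = Z *v (\<alpha>h + \<Delta>h *v \<gamma>h) + T *v (\<tau>h + \<delta>h *v \<gamma>h)"
    by (rule ls_reduced_fit[OF assms(1)])
next
  fix \<alpha>h \<gamma>h \<tau>h \<alpha>t \<tau>t \<Delta>h \<delta>h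
  assume "(\<alpha>h, \<gamma>h, \<tau>h) \<in> pr_full y Z U T" "(\<alpha>t, \<tau>t) \<in> pr_reduced y Z T"
    "(\<Delta>h, \<delta>h) \<in> pr_matrix U Z T"
  \<comment> \<open>The stacked product acts blockwise, so the two coefficient identities are
    exactly the two blocks of the goal.\<close>
  from pr_reduced_eq[OF assms(1,5) this]
  show "vec_stack \<alpha>t \<tau>t = vec_stack \<alpha>h \<tau>h + vec_stack \<Delta>h \<delta>h *v \<gamma>h"
    unfolding vec_stack_matrix_vector_mult
    by (simp add: vec_eq_iff vec_stack_def split: sum.split)
qed

end
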